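(* Let $f=[f_1,\dots,f_m]^T:\mathbb{R}^n\to\mathbb{R}^m$ be continuously differentiable, let $x_k\in\mathbb{R}^n$ be a point with $f(x_k)\neq0$ at which the Jacobian $f'(x_k)$ has full column rank, let $0<\eta<\frac12$ and $\beta\in[m]$, and let $$\xi_k=\frac{\sum_{\tau\in\binom{[m]}{\beta}}\|f_\tau(x_k)\|_2^2}{\sum_{\tau\in\binom{[m]}{\beta}}\|f_\tau(x_k)\|_\infty^2}.$$ Then $$\frac{1-2\eta}{1+\eta^2}\,\frac{\beta}{\xi_k}\,\frac{h_2^2(f'(x_k))}{\|f'(x_k)\|_{2,\infty}^2\,m}>\frac{1-2\eta}{(1+\eta)^2}\,\frac{h_2^2(f'(x_k))}{\|f'(x_k)\|_F^2\,m},$$ and hence $\rho_{\text{MR-SNK}}<\rho_{\text{NRK}}=\rho_{\text{NURK}}$, where $$\rho_{\text{MR-SNK}}=1-\frac{1-2\eta}{1+\eta^2}\,\frac{\beta}{\xi_k}\,\frac{h_2^2(f'(x_k))}{\|f'(x_k)\|_{2,\infty}^2\,m},\qquad \rho_{\text{NRK}}=\rho_{\text{NURK}}=1-\frac{1-2\eta}{(1+\eta)^2}\,\frac{h_2^2(f'(x_k))}{\|f'(x_k)\|_F^2\,m}.$$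
   Context: Notation: $[m]=\{1,\dots,m\}$; $\binom{[m]}{\beta}$ is the set of all subsets of $[m]$ of size $\beta$; $f_\tau(x)$ is the subvector of $f(x)$ indexed by $\tau$; $f'(x)=[\nabla f_1(x),\dots,\nabla f_m(x)]^T\in\mathbb{R}^{m\times n}$ is the Jacobian. For a matrix $A$ with rows $A^{(i)}$, $h_2(A)=\inf_{x\ne0}\|Ax\|_2/\|x\|_2$, $\|A\|_{2,\infty}=\max_i\|A^{(i)}\|_2$, and $\|A\|_F$ is the Frobenius norm. The quantities $\rho$ are the convergence factors of three nonlinear Kaczmarz methods (MR-SNK, NRK, NURK) and are defined by the displayed formulas. *)

theory Defs
  imports "HOL-Analysis.Analysis"
begin

text \<open>The index set $[m]$ is a finite type \<open>'m\<close> (so $m$ is \<open>CARD('m)\<close>, $n$ is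
  \<open>CARD('n)\<close>). The library's \<open>norm\<close> on \<open>real ^ 'n\<close> is the Euclidean norm, and
  \<open>jacobian f (at x)\<close> has the gradients of the components of \<open>f\<close> as its rows.\<close>

definition continuously_differentiable :: "(real ^ 'n \<Rightarrow> real ^ 'm) \<Rightarrow> bool" where
  "continuously_differentiable f \<longleftrightarrow>
     f differentiable_on UNIV \<and> continuous_on UNIV (\<lambda>x. jacobian f (at x))"

definition h2 :: "real ^ 'n ^ 'm \<Rightarrow> real" where
  "h2 A = (INF x\<in>{x. x \<noteq> 0}. norm (A *v x) / norm x)"

definition norm_2_inf :: "real ^ 'n ^ 'm \<Rightarrow> real" where
  "norm_2_inf A = (MAX i\<in>UNIV. norm (row i A))"

definition frobenius_norm :: "real ^ 'n ^ 'm \<Rightarrow> real" where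
  "frobenius_norm A = sqrt (\<Sum>i\<in>UNIV. \<Sum>j\<in>UNIV. (A $ i $ j)\<^sup>2)"

text \<open>Norms of the subvector of \<open>v\<close> indexed by \<open>\<tau>\<close>; the maximum norm is only
  meaningful for nonempty \<open>\<tau>\<close>.\<close>

definition sub_norm2 :: "'m set \<Rightarrow> real ^ 'm \<Rightarrow> real" where
  "sub_norm2 \<tau> v = L2_set (\<lambda>i. v $ i) \<tau>"

definition sub_norm_inf :: "'m set \<Rightarrow> real ^ 'm \<Rightarrow> real" where
  "sub_norm_inf \<tau> v = (MAX i\<in>\<tau>. \<bar>v $ i\<bar>)"

definition xi :: "(real ^ 'n \<Rightarrow> real ^ 'm) \<Rightarrow> nat \<Rightarrow> real ^ 'n \<Rightarrow> real" where
  "xi f \<beta> x =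
     (\<Sum>\<tau> | card \<tau> = \<beta>. (sub_norm2 \<tau> (f x))\<^sup>2) /
     (\<Sum>\<tau> | card \<tau> = \<beta>. (sub_norm_inf \<tau> (f x))\<^sup>2)"

definition rho_MR_SNK :: "(real ^ 'n \<Rightarrow> real ^ 'm) \<Rightarrow> real \<Rightarrow> nat \<Rightarrow> real ^ 'n \<Rightarrow> real" where
  "rho_MR_SNK f \<eta> \<beta> x =
     1 - (1 - 2 * \<eta>) / (1 + \<eta>\<^sup>2) * (real \<beta> / xi f \<beta> x) *
         ((h2 (jacobian f (at x)))\<^sup>2 / ((norm_2_inf (jacobian f (at x)))\<^sup>2 * real CARD('m)))"

definition rho_NRK :: "(real ^ 'n \<Rightarrow> real ^ 'm) \<Rightarrow> real \<Rightarrow> real ^ 'n \<Rightarrow> real" where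
  "rho_NRK f \<eta> x =
     1 - (1 - 2 * \<eta>) / (1 + \<eta>)\<^sup>2 *
         ((h2 (jacobian f (at x)))\<^sup>2 / ((frobenius_norm (jacobian f (at x)))\<^sup>2 * real CARD('m)))"

definition rho_NURK :: "(real ^ 'n \<Rightarrow> real ^ 'm) \<Rightarrow> real \<Rightarrow> real ^ 'n \<Rightarrow> real" where
  "rho_NURK f \<eta> x =
     1 - (1 - 2 * \<eta>) / (1 + \<eta>)\<^sup>2 *
         ((h2 (jacobian f (at x)))\<^sup>2 / ((frobenius_norm (jacobian f (at x)))\<^sup>2 * real CARD('m)))"

end

(* Each subvector satisfies |v_tau|_2^2 <= beta |v_tau|_inf^2, so xi <= beta, and the squared
   Frobenius norm dominates the squared norm of every single row. Hence replacing beta / xi by 1 and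
   the maximal row norm by the Frobenius norm only decreases the left-hand side; the strictness comes
   from 1 + eta^2 < (1 + eta)^2, since h_2 > 0 by full column rank. *)

theory Submission
  imports Defs
begin

text \<open>Full column rank makes the map injective, and an injective linear map in finite
  dimension is bounded below by a positive multiple of the norm; that multiple is a lower bound for
  the infimum.\<close>

lemma rank_eq_ncols_h2_pos:
  fixes A :: "real ^ 'n ^ 'm"
  assumes "rank A = CARD('n)"
  shows "0 < h2 A"
proof -
  have "inj ((*v) A)"
    using assms full_rank_injective by blast
  then obtain B where "B > 0" and B: "\<And>x. B * norm x \<le> norm (A *v x)"
    using linear_inj_bounded_below_pos[OF matrix_vector_mul_linear] by blast
  have "B \<le> h2 A"
    unfolding h2_def
  proof (rule cINF_greatest)
    \<comment> \<open>The infimum over an empty set would be unspecified; a unit coordinate vector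
      is a witness.\<close>
    show "{x :: real ^ 'n. x \<noteq> 0} \<noteq> {}"
      using axis_eq_0_iff[of undefined "1 :: real"] by blast
    show "B \<le> norm (A *v x) / norm x" if "x \<in> {x. x \<noteq> 0}" for x
      using that B[of x] by (simp add: pos_le_divide_eq)
  qed
  with \<open>B > 0\<close> show ?thesis by linarith
qed

lemma norm_row_le_norm_2_inf:
  fixes A :: "real ^ 'n ^ 'm"
  shows "norm (row i A) \<le> norm_2_inf A"
  unfolding norm_2_inf_def by (rule Max_ge) auto

lemma norm_2_inf_pos:
  fixes A :: "real ^ 'n ^ 'm"
  assumes "A \<noteq> 0"
  shows "0 < norm_2_inf A"
proof -
  obtain i where "row i A \<noteq> 0"
    using assms by (auto simp: vec_eq_iff row_def)
  then show ?thesis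
    using norm_row_le_norm_2_inf[of i A] by (smt (verit) zero_less_norm_iff)
qed

lemma norm_2_inf_le_frobenius_norm:
  fixes A :: "real ^ 'n ^ 'm"
  shows "norm_2_inf A \<le> frobenius_norm A"
proof -
  have "norm (row i A) \<le> frobenius_norm A" for i
  proof -
    have "(\<Sum>j\<in>UNIV. (A $ i $ j)\<^sup>2) \<le> (\<Sum>i\<in>UNIV. \<Sum>j\<in>UNIV. (A $ i $ j)\<^sup>2)"
      by (rule member_le_sum) (auto intro: sum_nonneg)
    then show ?thesis
      by (simp add: frobenius_norm_def norm_vec_def L2_set_def row_def)
  qed
  then show ?thesis
    unfolding norm_2_inf_def by (subst Max_le_iff) auto
qed

lemma abs_component_le_sub_norm_inf:
  fixes v :: "real ^ 'm"
  assumes "i \<in> \<tau>"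
  shows "\<bar>v $ i\<bar> \<le> sub_norm_inf \<tau> v"
  unfolding sub_norm_inf_def using assms by (intro Max_ge) auto

text \<open>Each of the \<open>card \<tau>\<close> squares is at most the squared maximum. For empty
  \<open>\<tau>\<close> both sides vanish, whatever \<open>Max\<close> yields there.\<close>

lemma sub_norm2_sq_le:
  fixes v :: "real ^ 'm"
  shows "(sub_norm2 \<tau> v)\<^sup>2 \<le> card \<tau> * (sub_norm_inf \<tau> v)\<^sup>2"
proof -
  have "(v $ i)\<^sup>2 \<le> (sub_norm_inf \<tau> v)\<^sup>2" if "i \<in> \<tau>" for i
    using power_mono[OF abs_component_le_sub_norm_inf[OF that, of v], of 2] by simp
  then show ?thesis
    using sum_bounded_above[of \<tau> "\<lambda>i. (v $ i)\<^sup>2"]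
    by (simp add: sub_norm2_def L2_set_def sum_nonneg)
qed

lemma abs_component_le_sub_norm2:
  fixes v :: "real ^ 'm"
  assumes "i \<in> \<tau>"
  shows "\<bar>v $ i\<bar> \<le> sub_norm2 \<tau> v"
  \<comment> \<open>Applied to absolute values, which the squares inside \<open>L2_set\<close>
    absorb.\<close>
  using member_le_L2_set[of \<tau> i "\<lambda>i. \<bar>v $ i\<bar>"] assms by (simp add: sub_norm2_def L2_set_def)

lemma xi_bounds:
  fixes f :: "real ^ 'n \<Rightarrow> real ^ 'm"
  assumes "f x \<noteq> 0" and "\<beta> \<in> {1..CARD('m)}"
  shows "0 < xi f \<beta> x" and "xi f \<beta> x \<le> \<beta>"
proof -
  obtain i where i: "f x $ i \<noteq> 0"
    using assms(1) by (auto simp: vec_eq_iff)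
  \<comment> \<open>Such a set exists since \<open>\<beta>\<close> lies between 1 and
    \<open>CARD('m)\<close>; its term alone makes both sums in \<open>xi\<close> positive.\<close>
  obtain \<tau> :: "'m set" where \<tau>: "{i} \<subseteq> \<tau>" "card \<tau> = \<beta>"
    using exists_subset_between[of "{i}" \<beta> UNIV] assms(2) by auto
  \<comment> \<open>The condition on \<open>g\<close> concerns only the set just obtained; the sum
    binds its own \<open>\<tau>\<close>.\<close>
  have sq_sum_pos: "0 < (\<Sum>\<tau> | card \<tau> = \<beta>. (g \<tau>)\<^sup>2)" if "\<bar>f x $ i\<bar> \<le> g \<tau>" for g :: "'m set \<Rightarrow> real"
    using i that \<tau>(2) by (intro sum_pos2[of _ \<tau>]) auto
  have num: "0 < (\<Sum>\<tau> | card \<tau> = \<beta>. (sub_norm2 \<tau> (f x))\<^sup>2)"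
    using \<tau>(1) by (intro sq_sum_pos abs_component_le_sub_norm2) auto
  have den: "0 < (\<Sum>\<tau> | card \<tau> = \<beta>. (sub_norm_inf \<tau> (f x))\<^sup>2)"
    using \<tau>(1) by (intro sq_sum_pos abs_component_le_sub_norm_inf) auto
  show "0 < xi f \<beta> x"
    unfolding xi_def using num den by (rule divide_pos_pos)
  have "(\<Sum>\<tau> | card \<tau> = \<beta>. (sub_norm2 \<tau> (f x))\<^sup>2)
      \<le> \<beta> * (\<Sum>\<tau> | card \<tau> = \<beta>. (sub_norm_inf \<tau> (f x))\<^sup>2)"
    unfolding sum_distrib_left by (rule sum_mono) (use sub_norm2_sq_le[of _ "f x"] in auto)
  with den show "xi f \<beta> x \<le> \<beta>"
    by (simp add: xi_def pos_divide_le_eq)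
qed

theorem mainTheorem7:
  fixes f :: "real ^ 'n \<Rightarrow> real ^ 'm" and xk :: "real ^ 'n" and \<eta> :: real and \<beta> :: nat
  assumes "continuously_differentiable f"
    and "f xk \<noteq> 0"
    and "rank (jacobian f (at xk)) = CARD('n)"
    and "0 < \<eta>" and "\<eta> < 1 / 2"
    and "\<beta> \<in> {1..CARD('m)}"
  shows "(1 - 2 * \<eta>) / (1 + \<eta>\<^sup>2) * (real \<beta> / xi f \<beta> xk) *
           ((h2 (jacobian f (at xk)))\<^sup>2 /
             ((norm_2_inf (jacobian f (at xk)))\<^sup>2 * real CARD('m)))
         > (1 - 2 * \<eta>) / (1 + \<eta>)\<^sup>2 *
           ((h2 (jacobian f (at xk)))\<^sup>2 /
             ((frobenius_norm (jacobian f (at xk)))\<^sup>2 * real CARD('m)))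
       \<and> rho_MR_SNK f \<eta> \<beta> xk < rho_NRK f \<eta> xk
       \<and> rho_NRK f \<eta> xk = rho_NURK f \<eta> xk"
proof -
  define A where "A = jacobian f (at xk)"
  define H where "H = (h2 A)\<^sup>2"
  define M where "M = (norm_2_inf A)\<^sup>2 * real CARD('m)"
  define F where "F = (frobenius_norm A)\<^sup>2 * real CARD('m)"
  have rank: "rank A = CARD('n)"
    using assms(3) by (simp add: A_def)
  \<comment> \<open>The zero matrix has rank 0, but \<open>CARD('n)\<close> is positive.\<close>
  have "A \<noteq> 0"
    using rank by (metis rank_0 zero_less_card_finite less_irrefl)
  then have "0 < norm_2_inf A"
    by (rule norm_2_inf_pos)
  then have M: "0 < M" "M \<le> F"
    using norm_2_inf_le_frobenius_norm[of A]
    by (auto simp: M_def F_def intro!: mult_right_mono power_mono)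
  have "0 < H"
    using rank_eq_ncols_h2_pos[OF rank] by (simp add: H_def)
  have "1 \<le> real \<beta> / xi f \<beta> xk"
    using xi_bounds[of f xk \<beta>, OF assms(2,6)] by simp
  \<comment> \<open>Only the factor in \<open>\<eta>\<close> changes here. The strict inequality
    survives multiplication because \<open>H / F\<close> is positive.\<close>
  have "(1 - 2 * \<eta>) / (1 + \<eta>)\<^sup>2 * (H / F) < (1 - 2 * \<eta>) / (1 + \<eta>\<^sup>2) * (H / F)"
  proof (rule mult_strict_right_mono)
    \<comment> \<open>The two sides differ by \<open>2 * \<eta>\<close>.\<close>
    have "1 + \<eta>\<^sup>2 < (1 + \<eta>)\<^sup>2"
      using \<open>0 < \<eta>\<close> by (simp add: power2_eq_square algebra_simps)
    then show "(1 - 2 * \<eta>) / (1 + \<eta>)\<^sup>2 < (1 - 2 * \<eta>) / (1 + \<eta>\<^sup>2)"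
      using \<open>0 < \<eta>\<close> \<open>\<eta> < 1 / 2\<close> by (intro divide_strict_left_mono) (auto simp: add_pos_nonneg)
    show "0 < H / F"
      using \<open>0 < H\<close> M by simp
  qed
  also have "\<dots> \<le> (1 - 2 * \<eta>) / (1 + \<eta>\<^sup>2) * (real \<beta> / xi f \<beta> xk) * (H / M)"
  proof (rule mult_mono)
    have "0 \<le> (1 - 2 * \<eta>) / (1 + \<eta>\<^sup>2)"
      using \<open>\<eta> < 1 / 2\<close> by simp
    with \<open>1 \<le> real \<beta> / xi f \<beta> xk\<close>
    show "(1 - 2 * \<eta>) / (1 + \<eta>\<^sup>2) \<le> (1 - 2 * \<eta>) / (1 + \<eta>\<^sup>2) * (real \<beta> / xi f \<beta> xk)"
      and "0 \<le> (1 - 2 * \<eta>) / (1 + \<eta>\<^sup>2) * (real \<beta> / xi f \<beta> xk)"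
      using mult_left_mono[of 1 "real \<beta> / xi f \<beta> xk" "(1 - 2 * \<eta>) / (1 + \<eta>\<^sup>2)"] by simp_all
    show "H / F \<le> H / M"
      using \<open>0 < H\<close> M by (intro divide_left_mono) auto
    show "0 \<le> H / F"
      using \<open>0 < H\<close> M by simp
  qed
  \<comment> \<open>Subtracting from 1 reverses the inequality, which gives the comparison of the
    convergence factors.\<close>
  finally show ?thesis
    unfolding rho_MR_SNK_def rho_NRK_def rho_NURK_def H_def M_def F_def A_def by simp
qed

end
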